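(* Let $\Delta=\frac{d^2}{dx^2}$ be the Laplacian on the unit interval $I=[0,1]$, taken with Dirichlet boundary conditions. If $\lambda$ is not a Dirichlet eigenvalue of $\Delta$, then the resolvent kernel $G^{(\lambda)}$, i.e. the kernel with $\int_0^1G^{(\lambda)}(x,y)f(y)\,dy=(\lambda\,\mathrm{id}-\Delta)^{-1}f(x)$, is given by $$G^{(\lambda)}(x,y)=\sum_{m=0}^\infty\ \sum_{|w|=m}\frac1{2^m}\,\Psi^{(\lambda/4^m)}(F_w^{-1}x,F_w^{-1}y),$$ where $$\Psi^{(\lambda)}(x,y):=\frac{\sinh\frac{\sqrt\lambda}2}{2\sqrt\lambda\cosh\frac{\sqrt\lambda}2}\,\psi^{(\lambda)}(x)\,\psi^{(\lambda)}(y),\qquad \psi^{(\lambda)}(x):=\frac1{\sinh\frac{\sqrt\lambda}2}\begin{cases}\sinh(\sqrt\lambda\,x),&x\le\frac12,\\ \sinh(\sqrt\lambda\,(1-x)),&x\ge\frac12,\end{cases}$$ and by convention $\Psi^{(\lambda/4^m)}(F_w^{-1}x,F_w^{-1}y)=0$ unless both $x$ and $y$ lie in $F_w(I)$.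
   Context: $F_1(x)=\frac x2$ and $F_2(x)=\frac x2+\frac12$. For a word $w=w_1\cdots w_m$ on $\{1,2\}$ of length $|w|=m$, $F_w=F_{w_1}\circ\cdots\circ F_{w_m}$ ($F_w=\mathrm{id}$ for $m=0$). A Dirichlet eigenvalue of $\Delta$ is a number $\lambda$ for which $u''=\lambda u$ has a nonzero solution on $[0,1]$ with $u(0)=u(1)=0$. $(\lambda\,\mathrm{id}-\Delta)^{-1}f$ is the unique $u$ with $\lambda u-u''=f$ and $u(0)=u(1)=0$. For $\lambda=0$ the formulas for $\psi^{(\lambda)}$ and $\Psi^{(\lambda)}$ are understood as limits as $\lambda\to0$. *)

theory Defs
  imports "HOL-Analysis.Analysis"
begin

(* Spectral parameters and functions on I = [0,1] are complex-valued; functions on I are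
   represented by total functions on the reals whose values outside I are irrelevant.
   Derivatives at 0 and 1 are one-sided. *)

definition dirichlet_laplacian :: "(real \<Rightarrow> complex) \<Rightarrow> (real \<Rightarrow> complex) \<Rightarrow> bool" where
  "dirichlet_laplacian u g \<longleftrightarrow>
     u 0 = 0 \<and> u 1 = 0 \<and>
     (\<exists>u'. \<forall>x\<in>{0..1}.
        (u has_vector_derivative u' x) (at x within {0..1}) \<and>
        (u' has_vector_derivative g x) (at x within {0..1}))"

definition dirichlet_eigenvalue :: "complex \<Rightarrow> bool" where
  "dirichlet_eigenvalue lam \<longleftrightarrow>
     (\<exists>u. (\<exists>x\<in>{0..1}. u x \<noteq> 0) \<and> dirichlet_laplacian u (\<lambda>x. lam * u x))"

definition solves_resolvent_eq :: "complex \<Rightarrow> (real \<Rightarrow> complex) \<Rightarrow> (real \<Rightarrow> complex) \<Rightarrow> bool" where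
  "solves_resolvent_eq lam f u \<longleftrightarrow>
     (\<exists>g. dirichlet_laplacian u g \<and> (\<forall>x\<in>{0..1}. lam * u x - g x = f x))"

(* u = (lam id - Delta)^{-1} f on I. A relation rather than a function, since u is
   determined on I only. *)
definition is_resolvent :: "complex \<Rightarrow> (real \<Rightarrow> complex) \<Rightarrow> (real \<Rightarrow> complex) \<Rightarrow> bool" where
  "is_resolvent lam f u \<longleftrightarrow>
     solves_resolvent_eq lam f u \<and>
     (\<forall>v. solves_resolvent_eq lam f v \<longrightarrow> (\<forall>x\<in>{0..1}. v x = u x))"

(* The right-hand sides f range over the continuous functions on I, for which the
   equation lam u - u'' = f is meant classically. This determines each G(x,.) almost
   everywhere. *)
definition resolvent_kernel :: "complex \<Rightarrow> (real \<Rightarrow> real \<Rightarrow> complex) \<Rightarrow> bool" where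
  "resolvent_kernel lam G \<longleftrightarrow>
     (\<forall>f. continuous_on {0..1} f \<longrightarrow>
        (\<forall>x\<in>{0..1}. integrable (lebesgue_on {0..1}) (\<lambda>y. G x y * f y)) \<and>
        is_resolvent lam f (\<lambda>x. \<integral>y. G x y * f y \<partial>lebesgue_on {0..1}))"

(* The choice of the square root is immaterial: psi and Psi below are even in csqrt lam. *)
definition psi_nz :: "complex \<Rightarrow> real \<Rightarrow> complex" where
  "psi_nz lam x =
     1 / sinh (csqrt lam / 2) *
     (if x \<le> 1/2 then sinh (csqrt lam * of_real x) else sinh (csqrt lam * of_real (1 - x)))"

definition psi :: "complex \<Rightarrow> real \<Rightarrow> complex" where
  "psi lam x = (if lam = 0 then Lim (at 0) (\<lambda>z. psi_nz z x) else psi_nz lam x)"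

definition Psi_nz :: "complex \<Rightarrow> real \<Rightarrow> real \<Rightarrow> complex" where
  "Psi_nz lam x y =
     sinh (csqrt lam / 2) / (2 * csqrt lam * cosh (csqrt lam / 2)) * psi lam x * psi lam y"

definition Psi :: "complex \<Rightarrow> real \<Rightarrow> real \<Rightarrow> complex" where
  "Psi lam x y = (if lam = 0 then Lim (at 0) (\<lambda>z. Psi_nz z x y) else Psi_nz lam x y)"

definition F :: "nat \<Rightarrow> real \<Rightarrow> real" where
  "F i x = (if i = 1 then x / 2 else x / 2 + 1 / 2)"

definition F_word :: "nat list \<Rightarrow> real \<Rightarrow> real" where
  "F_word w = foldr (\<lambda>i g. F i \<circ> g) w id"

definition words :: "nat \<Rightarrow> nat list set" where
  "words m = {w. set w \<subseteq> {1, 2} \<and> length w = m}"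

(* F_word w is a bijection of the real line, so inv is its genuine inverse. *)
definition Psi_cell :: "complex \<Rightarrow> nat list \<Rightarrow> real \<Rightarrow> real \<Rightarrow> complex" where
  "Psi_cell lam w x y =
     (if x \<in> F_word w ` {0..1} \<and> y \<in> F_word w ` {0..1}
      then Psi lam (inv (F_word w) x) (inv (F_word w) y) else 0)"

definition resolvent_term :: "complex \<Rightarrow> real \<Rightarrow> real \<Rightarrow> nat \<Rightarrow> complex" where
  "resolvent_term lam x y m = (\<Sum>w\<in>words m. 1 / 2 ^ m * Psi_cell (lam / 4 ^ m) w x y)"

end

theory Submission
  imports Defs
begin

text \<open>
  Write \<open>s\<close> for a square root of the spectral parameter and \<open>S t = sinh (s t) / s\<close>, the solution
  of \<open>u'' = s\<^sup>2 u\<close> with \<open>u 0 = 0\<close> and \<open>u' 0 = 1\<close>. If \<open>S 1 = 0\<close>, then \<open>S\<close> is a Dirichlet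
  eigenfunction. Otherwise the classical Green function, glued from the solutions \<open>S x\<close> and
  \<open>S (1 - x)\<close> that vanish at one end each,
    \<open>G[s] x y = S (min x y) S (1 - max x y) / S 1\<close>,
  is the resolvent kernel by variation of parameters.

  The series comes from the self-similarity of this closed form. If \<open>x\<close> and \<open>y\<close> lie in the same half
  of the interval, and \<open>f\<close> is the affine map of that half onto \<open>[0,1]\<close>, the addition theorem gives
    \<open>G[s] x y = \<Psi> x y + 1/2 G[s/2] (f x) (f y)\<close>;
  if they lie in different halves, \<open>G[s] x y = \<Psi> x y\<close> (\<open>green_self_similar\<close>). Halving \<open>s\<close> means
  dividing the spectral parameter by 4. Iterating \<open>M\<close> times produces the \<open>M\<close>-th partial sum with a
  remainder made of copies of \<open>G[s / 2^M]\<close>, weighted by \<open>1 / 2^M\<close>. Cells of one level meet only in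
  points where these copies vanish (\<open>remainder_bound\<close>), and the copies are bounded uniformly in \<open>M\<close>:
  their numerators are, and their denominators tend to 1 (\<open>green_bound_scaled\<close>). So the remainder is
  \<open>O(1 / 2^M)\<close>.

  Any other resolvent kernel has the same integrals against continuous functions, hence agrees
  with \<open>G[s]\<close> almost everywhere in \<open>y\<close> (\<open>AE_zero_if_orthogonal_to_continuous\<close>).
\<close>

section \<open>The fundamental solution\<close>

text \<open>The value at \<open>s = 0\<close> is the limit, which makes the function entire in \<open>s\<close>. Identities and derivatives
  in \<open>t\<close> then hold uniformly, including the spectral parameter 0.\<close>
definition sinhq :: "complex \<Rightarrow> real \<Rightarrow> complex" where
  "sinhq s t = (if s = 0 then of_real t else sinh (s * of_real t) / s)"

lemma sinhq_0 [simp]: "sinhq s 0 = 0"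
  by (simp add: sinhq_def)

lemma sinhq_minus: "sinhq s (- t) = - sinhq s t"
  by (simp add: sinhq_def)

lemma sinhq_add:
  "sinhq s (t + t') = sinhq s t * cosh (s * of_real t') + cosh (s * of_real t) * sinhq s t'"
  by (simp add: sinhq_def sinh_add distrib_left add_divide_distrib)

lemma sinhq_half_parameter: "sinhq (s / 2) (2 * t) = 2 * sinhq s t"
  by (simp add: sinhq_def)

lemma sinhq_1_factor: "sinhq s 1 = cosh (s / 2) * sinhq (s / 2) 1"
  using sinhq_add[of s "1/2" "1/2"] sinhq_half_parameter[of s "1/2"] by simp

lemma sinhq_has_vector_derivative:
  "(sinhq s has_vector_derivative cosh (s * of_real t)) (at t within A)"
proof (cases "s = 0")
  case True
  have "((\<lambda>t. of_real t :: complex) has_vector_derivative of_real 1) (at t within A)"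
    by (intro derivative_intros)
  with True show ?thesis by (simp add: sinhq_def[abs_def])
next
  case False
  have "((\<lambda>z. sinh (s * z) / s) has_field_derivative cosh (s * of_real t)) (at (of_real t))"
    using False by (auto intro!: derivative_eq_intros)
  from has_vector_derivative_real_field[OF this] False show ?thesis
    by (simp add: sinhq_def[abs_def])
qed

lemma cosh_has_vector_derivative:
  "((\<lambda>t. cosh (s * of_real t)) has_vector_derivative s\<^sup>2 * sinhq s t) (at t within A)"
proof -
  have "((\<lambda>z. cosh (s * z)) has_field_derivative s\<^sup>2 * sinhq s t) (at (of_real t))"
    by (auto intro!: derivative_eq_intros simp: sinhq_def power2_eq_square)
  from has_vector_derivative_real_field[OF this] show ?thesis .
qed

lemma continuous_on_sinhq [continuous_intros]:
  assumes "continuous_on A f"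
  shows "continuous_on A (\<lambda>x. sinhq s (f x))"
proof -
  have "continuous_on UNIV (sinhq s)"
    by (rule continuous_on_vector_derivative[OF sinhq_has_vector_derivative])
  from continuous_on_compose2[OF this assms] show ?thesis by auto
qed

lemma sinhq_tendsto: "((\<lambda>s. sinhq s t) \<longlongrightarrow> of_real t) (at 0)"
proof -
  have "((\<lambda>s. sinh (s * of_real t)) has_field_derivative of_real t) (at (0::complex))"
    by (auto intro!: derivative_eq_intros)
  then have "((\<lambda>s. sinh (s * of_real t) / s) \<longlongrightarrow> (of_real t :: complex)) (at 0)"
    by (simp add: has_field_derivative_iff)
  moreover have "eventually (\<lambda>s. sinh (s * of_real t) / s = sinhq s t) (at (0::complex))"
    by (simp add: eventually_at_filter sinhq_def)
  ultimately show ?thesis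
    by (rule Lim_transform_eventually)
qed

text \<open>If \<open>S 1 = 0\<close>, then \<open>S\<close> itself is an eigenfunction: it is not identically zero since its derivative
  at 0 is 1.\<close>
lemma sinhq_zero_imp_dirichlet_eigenvalue:
  assumes "sinhq (csqrt lam) 1 = 0"
  shows "dirichlet_eigenvalue lam"
  unfolding dirichlet_eigenvalue_def
proof (intro exI conjI)
  let ?s = "csqrt lam"
  show "\<exists>x\<in>{0..1}. sinhq ?s x \<noteq> 0"
  proof (rule ccontr)
    assume "\<not> (\<exists>x\<in>{0..1}. sinhq ?s x \<noteq> 0)"
    then have z: "\<And>x. x \<in> {0..1} \<Longrightarrow> 0 = sinhq ?s x" by auto
    have "((\<lambda>x. 0) has_vector_derivative (0::complex)) (at 0 within {0..1::real})"
      by (rule has_vector_derivative_const)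
    then have "(sinhq ?s has_vector_derivative 0) (at 0 within {0..1})"
      by (rule has_vector_derivative_transform[rotated 2]) (use z in auto)
    moreover have "(sinhq ?s has_vector_derivative 1) (at 0 within {0..1})"
      using sinhq_has_vector_derivative[of ?s 0] by simp
    ultimately show False
      using vector_derivative_unique_within_closed_interval[of 0 1 0 "sinhq ?s" 0 1] by simp
  qed
  have "(sinhq ?s has_vector_derivative cosh (?s * of_real x)) (at x within {0..1}) \<and>
        ((\<lambda>t. cosh (?s * of_real t)) has_vector_derivative lam * sinhq ?s x) (at x within {0..1})" for x
    using sinhq_has_vector_derivative cosh_has_vector_derivative[of ?s] by simp
  then show "dirichlet_laplacian (sinhq ?s) (\<lambda>x. lam * sinhq ?s x)"
    using assms unfolding dirichlet_laplacian_def
    by (intro conjI exI[of _ "\<lambda>t. cosh (?s * of_real t)"]) auto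
qed

section \<open>A closed form for the function \<open>\<Psi>\<close>\<close>

definition tent :: "real \<Rightarrow> real" where
  "tent x = min x (1 - x)"

lemma psi_nz_eq:
  assumes "z \<noteq> 0"
  shows "psi_nz z x = sinhq (csqrt z) (tent x) / sinhq (csqrt z) (1/2)"
  using assms by (auto simp: psi_nz_def sinhq_def tent_def)

lemma Psi_nz_eq:
  assumes "z \<noteq> 0" and "sinhq (csqrt z) 1 \<noteq> 0"
  shows "Psi_nz z x y =
    sinhq (csqrt z) (tent x) * sinhq (csqrt z) (tent y) / sinhq (csqrt z) 1"
proof -
  let ?s = "csqrt z"
  have one: "sinhq ?s 1 = 2 * (sinh (?s / 2) * cosh (?s / 2) / ?s)"
    using sinhq_add[of ?s "1/2" "1/2"] assms by (simp add: sinhq_def)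
  with assms have "sinh (?s / 2) \<noteq> 0" "cosh (?s / 2) \<noteq> 0" by auto
  moreover have "sinhq ?s (1/2) = sinh (?s / 2) / ?s"
    using assms by (simp add: sinhq_def)
  ultimately show ?thesis
    using assms(1) unfolding Psi_nz_def psi_def one
    by (simp add: psi_nz_eq mult_ac)
qed

lemma tendsto_csqrt_0: "filterlim csqrt (at 0) (at 0)"
proof -
  have "((\<lambda>z::complex. sqrt (norm z)) \<longlongrightarrow> sqrt (norm (0::complex))) (at 0)"
    by (intro tendsto_intros)
  then have "((\<lambda>z. norm (csqrt z)) \<longlongrightarrow> 0) (at 0)"
    by simp
  then have "(csqrt \<longlongrightarrow> 0) (at 0)"
    by (rule tendsto_norm_zero_cancel)
  then show ?thesis
    by (simp add: filterlim_at eventually_at_filter)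
qed

text \<open>Expressed by \<open>S\<close>, the removable singularity at \<open>lam = 0\<close> disappears: the factor
  \<open>sinh (s / 2) / (2 s cosh (s / 2))\<close> equals \<open>(S (1/2))\<^sup>2 / S 1\<close>, which cancels the normalization of \<open>\<psi>\<close>.\<close>
lemma Psi_eq:
  assumes "sinhq (csqrt lam) 1 \<noteq> 0"
  shows "Psi lam x y =
    sinhq (csqrt lam) (tent x) * sinhq (csqrt lam) (tent y) / sinhq (csqrt lam) 1"
proof (cases "lam = 0")
  case False
  then show ?thesis using assms by (simp add: Psi_def Psi_nz_eq)
next
  case True
  have lim: "((\<lambda>z. sinhq (csqrt z) t) \<longlongrightarrow> of_real t) (at 0)" for t
    by (rule filterlim_compose[OF sinhq_tendsto tendsto_csqrt_0])
  have "eventually (\<lambda>z. sinhq (csqrt z) 1 \<noteq> 0) (at 0)"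
    using tendsto_imp_eventually_ne[OF lim[of 1]] by simp
  moreover have "eventually (\<lambda>z::complex. z \<noteq> 0) (at 0)"
    by (simp add: eventually_at_filter)
  ultimately have ev: "eventually (\<lambda>z. sinhq (csqrt z) (tent x) * sinhq (csqrt z) (tent y) /
      sinhq (csqrt z) 1 = Psi_nz z x y) (at 0)"
    by eventually_elim (simp add: Psi_nz_eq)
  have "((\<lambda>z. sinhq (csqrt z) (tent x) * sinhq (csqrt z) (tent y) / sinhq (csqrt z) 1)
      \<longlongrightarrow> of_real (tent x) * of_real (tent y) / of_real 1) (at 0)"
    by (intro tendsto_intros lim) simp
  from Lim_transform_eventually[OF this ev]
  have "((\<lambda>z. Psi_nz z x y) \<longlongrightarrow> of_real (tent x) * of_real (tent y)) (at 0)"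
    by simp
  then have "Lim (at 0) (\<lambda>z. Psi_nz z x y) = of_real (tent x) * of_real (tent y)"
    by (intro tendsto_Lim) auto
  with True show ?thesis by (simp add: Psi_def sinhq_def)
qed

section \<open>The Green function and its self-similarity\<close>

text \<open>The parameter is \<open>s\<close> rather than \<open>s\<^sup>2\<close>, so that passing to a subinterval of half the length just
  halves it.\<close>
definition green :: "complex \<Rightarrow> real \<Rightarrow> real \<Rightarrow> complex" where
  "green s x y = sinhq s (min x y) * sinhq s (1 - max x y) / sinhq s 1"

lemma green_commute: "green s x y = green s y x"
  by (simp add: green_def min.commute max.commute)

lemma green_reflect: "green s (1 - x) (1 - y) = green s x y"
proof -
  have "min (1 - x) (1 - y) = 1 - max x y" "1 - max (1 - x) (1 - y) = min x y" by auto
  then show ?thesis by (simp add: green_def mult.commute)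
qed

lemma green_boundary:
  assumes "x \<in> {0, 1} \<or> y \<in> {0, 1}" "x \<in> {0..1}" "y \<in> {0..1}"
  shows "green s x y = 0"
  using assms by (auto simp: green_def min_def max_def)

lemma continuous_on_green: "continuous_on A (\<lambda>(x, y). green s x y)"
  unfolding green_def case_prod_unfold
  by (cases "sinhq s 1 = 0") (auto intro!: continuous_intros)

lemma continuous_on_green_row: "continuous_on A (green s x)"
  unfolding green_def[abs_def]
  by (cases "sinhq s 1 = 0") (auto intro!: continuous_intros)

text \<open>For \<open>x \<le> y\<close> all three terms have the factor \<open>S x\<close>. What is left is the identity
  \<open>S (1 - y) = S y + 2 cosh (s / 2) S (1/2 - y)\<close>, the addition theorem around the midpoint, in which
  the hyperbolic cosine is the quotient of the denominators belonging to \<open>s\<close> and \<open>s / 2\<close>.\<close>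
lemma green_lower_half:
  assumes nz: "sinhq s 1 \<noteq> 0" and "x \<le> 1/2" "y \<le> 1/2"
  shows "green s x y =
    sinhq s x * sinhq s y / sinhq s 1 + 1/2 * green (s / 2) (2 * x) (2 * y)"
  using assms(2,3)
proof (induction x y rule: linorder_wlog)
  case (sym x y)
  then show ?case by (simp add: green_commute mult.commute)
next
  case (le x y)
  have nz': "sinhq (s / 2) 1 \<noteq> 0" "cosh (s / 2) \<noteq> 0"
    using nz unfolding sinhq_1_factor[of s] by auto
  have half: "sinhq (s / 2) (1 - 2 * y) = 2 * sinhq s (1/2 - y)"
    using sinhq_half_parameter[of s "1/2 - y"] by (simp add: right_diff_distrib)
  have dbl: "sinhq (s / 2) (2 * x) = 2 * sinhq s x"
    by (rule sinhq_half_parameter)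
  define d where "d = 1/2 - y"
  have "sinhq s (1 - y) = sinhq s d * cosh (s / 2) + cosh (s * of_real d) * sinhq s (1/2)"
    using sinhq_add[of s d "1/2"] by (simp add: d_def)
  moreover have "sinhq s y = sinhq s (1/2) * cosh (s * of_real d) - cosh (s / 2) * sinhq s d"
    using sinhq_add[of s "1/2" "- d"] by (simp add: sinhq_minus) (simp add: d_def)
  ultimately have key: "sinhq s (1 - y) = sinhq s y + 2 * cosh (s / 2) * sinhq s (1/2 - y)"
    by (simp add: algebra_simps flip: d_def)
  have "green s x y = sinhq s x * sinhq s y / sinhq s 1
      + 2 * sinhq s x * cosh (s / 2) * sinhq s (1/2 - y) / sinhq s 1"
    using le by (simp add: green_def key field_simps add_divide_distrib)
  also have "2 * sinhq s x * cosh (s / 2) * sinhq s (1/2 - y) / sinhq s 1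
      = 1/2 * green (s / 2) (2 * x) (2 * y)"
    using le nz' unfolding sinhq_1_factor[of s]
    by (simp add: green_def half dbl)
  finally show ?case .
qed

text \<open>The upper half reduces to the lower one by reflection. Both conditions hold only for
  \<open>x = y = 1/2\<close>, where the Green functions of both halves vanish. If \<open>x\<close> and \<open>y\<close> lie in
  different halves, \<open>\<Psi>\<close> alone coincides with the Green function.\<close>
lemma green_self_similar:
  assumes nz: "sinhq s 1 \<noteq> 0" and "x \<in> {0..1}" "y \<in> {0..1}"
  shows "green s x y = sinhq s (tent x) * sinhq s (tent y) / sinhq s 1
    + (if x \<le> 1/2 \<and> y \<le> 1/2 then 1/2 * green (s / 2) (2 * x) (2 * y) else 0)
    + (if 1/2 \<le> x \<and> 1/2 \<le> y then 1/2 * green (s / 2) (2 * x - 1) (2 * y - 1) else 0)"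
proof -
  have up: "green s x y = sinhq s (1 - x) * sinhq s (1 - y) / sinhq s 1
      + 1/2 * green (s / 2) (2 * x - 1) (2 * y - 1)" if "1/2 \<le> x" "1/2 \<le> y"
  proof -
    have "green (s / 2) (2 * (1 - x)) (2 * (1 - y)) = green (s / 2) (2 * x - 1) (2 * y - 1)"
      using green_reflect[of "s / 2" "2 * x - 1" "2 * y - 1"] by (simp add: algebra_simps)
    then show ?thesis
      using green_lower_half[OF nz, of "1 - x" "1 - y"] that by (simp add: green_reflect)
  qed
  consider "x < 1/2" "y < 1/2" | "1/2 < x" "1/2 < y" | "x = 1/2 \<or> y = 1/2"
    | "x < 1/2" "1/2 < y" | "1/2 < x" "y < 1/2" by linarith
  then show ?thesis
  proof cases
    case 1
    then show ?thesis using green_lower_half[OF nz, of x y] by (simp add: tent_def)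
  next
    case 2
    then show ?thesis using up by (simp add: tent_def)
  next
    case 3
    have lower0: "green (s / 2) (2 * x) (2 * y) = 0" if "x \<le> 1/2" "y \<le> 1/2"
      by (rule green_boundary) (use 3 that assms(2,3) in auto)
    have upper0: "green (s / 2) (2 * x - 1) (2 * y - 1) = 0" if "1/2 \<le> x" "1/2 \<le> y"
      by (rule green_boundary) (use 3 that assms(2,3) in auto)
    consider "x \<le> 1/2" "y \<le> 1/2" | "1/2 \<le> x" "1/2 \<le> y" using 3 by linarith
    then show ?thesis
    proof cases
      case 1
      then have "tent x = x" "tent y = y" by (auto simp: tent_def)
      with 1 show ?thesis
        using green_lower_half[OF nz 1] upper0 by auto
    next
      case 2
      then have "tent x = 1 - x" "tent y = 1 - y" by (auto simp: tent_def)
      with 2 show ?thesis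
        using up lower0 by auto
    qed
  qed (simp_all add: tent_def green_def min_def max_def)
qed

section \<open>Cells and the recursion for the terms of the series\<close>

lemma csqrt_quarter: "csqrt (lam / 4) = csqrt lam / 2"
  using csqrt_principal[of lam] by (intro csqrt_unique) (auto simp: power_divide)

lemma sinhq_1_half_nonzero: "sinhq s 1 \<noteq> 0 \<Longrightarrow> sinhq (s / 2) 1 \<noteq> 0"
  using sinhq_1_factor[of s] by auto

lemma F_word_Nil: "F_word [] = id"
  by (simp add: F_word_def)

lemma F_word_Cons: "F_word (i # w) = F i \<circ> F_word w"
  by (simp add: F_word_def)

lemma bij_F: "bij (F i)"
  by (rule bij_betw_byWitness[where f' = "\<lambda>x. if i = 1 then 2 * x else 2 * x - 1"])
     (auto simp: F_def diff_divide_distrib)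

lemma bij_F_word: "bij (F_word w)"
proof (induction w)
  case (Cons i w)
  show ?case unfolding F_word_Cons by (rule bij_comp[OF Cons bij_F])
qed (simp only: F_word_Nil bij_id)

lemma F_word_unit_interval: "F_word w ` {0..1} \<subseteq> {0..1}"
proof (induction w)
  case (Cons i w)
  have "F i ` {0..1} \<subseteq> {0..1}" by (auto simp: F_def)
  with Cons show ?case by (auto simp: F_word_Cons image_subset_iff)
qed (simp add: F_word_Nil)

lemma inv_F: "inv (F i) x = (if i = 1 then 2 * x else 2 * x - 1)"
  by (rule inv_f_eq[OF bij_is_inj[OF bij_F]]) (simp add: F_def diff_divide_distrib)

lemma F_image_unit_interval: "F i ` {0..1} = (if i = 1 then {0..1/2} else {1/2..1})"
proof -
  have "x \<in> F i ` {0..1} \<longleftrightarrow> inv (F i) x \<in> {0..1}" for x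
  proof
    assume "x \<in> F i ` {0..1}"
    then show "inv (F i) x \<in> {0..1}" by (auto simp: inv_f_f[OF bij_is_inj[OF bij_F]])
  next
    assume "inv (F i) x \<in> {0..1}"
    then have "F i (inv (F i) x) \<in> F i ` {0..1}" by blast
    then show "x \<in> F i ` {0..1}" by (simp only: surj_f_inv_f[OF bij_is_surj[OF bij_F]])
  qed
  then show ?thesis by (intro set_eqI) (auto simp: inv_F)
qed

text \<open>Peeling off the first letter, the outermost map, matches the recursion of the Green function. As
  \<open>F_word w\<close> maps the unit interval into itself, the cell of \<open>i # w\<close> lies in the cell of \<open>i\<close>.\<close>
lemma Psi_cell_Cons:
  "Psi_cell lam (i # w) x y =
    (if x \<in> F i ` {0..1} \<and> y \<in> F i ` {0..1}
     then Psi_cell lam w (inv (F i) x) (inv (F i) y) else 0)"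
proof -
  have mem: "z \<in> F_word (i # w) ` {0..1} \<longleftrightarrow>
      z \<in> F i ` {0..1} \<and> inv (F i) z \<in> F_word w ` {0..1}" for z
  proof
    assume "z \<in> F_word (i # w) ` {0..1}"
    then obtain t where "t \<in> {0..1}" "z = F i (F_word w t)" by (auto simp: F_word_Cons)
    then show "z \<in> F i ` {0..1} \<and> inv (F i) z \<in> F_word w ` {0..1}"
      using F_word_unit_interval[of w]
      by (intro conjI) (blast, simp add: inv_f_f[OF bij_is_inj[OF bij_F]])
  next
    assume "z \<in> F i ` {0..1} \<and> inv (F i) z \<in> F_word w ` {0..1}"
    then obtain t where "t \<in> {0..1}" "inv (F i) z = F_word w t" by auto
    then have "z = F i (F_word w t)" by (metis surj_f_inv_f[OF bij_is_surj[OF bij_F]])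
    with \<open>t \<in> {0..1}\<close> show "z \<in> F_word (i # w) ` {0..1}" by (auto simp: F_word_Cons)
  qed
  have "inv (F_word (i # w)) = inv (F_word w) \<circ> inv (F i)"
    by (simp add: F_word_Cons o_inv_distrib bij_F bij_F_word)
  then show ?thesis by (auto simp: Psi_cell_def mem)
qed

lemma words_0: "words 0 = {[]}"
  by (auto simp: words_def)

lemma words_Suc: "words (Suc m) = (#) 1 ` words m \<union> (#) 2 ` words m"
  by (auto simp: words_def length_Suc_conv image_iff)

lemma finite_words: "finite (words m)"
  by (induction m) (auto simp: words_0 words_Suc)

lemma sum_words_Suc:
  "(\<Sum>w\<in>words (Suc m). h w) = (\<Sum>w\<in>words m. h (1 # w)) + (\<Sum>w\<in>words m. h (2 # w))"
  unfolding words_Suc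
  by (subst sum.union_disjoint) (auto simp: finite_words sum.reindex inj_on_def)

lemma resolvent_term_0:
  assumes "x \<in> {0..1}" "y \<in> {0..1}"
  shows "resolvent_term lam x y 0 = Psi lam x y"
  using assms by (simp add: resolvent_term_def words_0 Psi_cell_def F_word_Nil)

lemma resolvent_term_Suc:
  assumes "x \<in> {0..1}" "y \<in> {0..1}"
  shows "resolvent_term lam x y (Suc m) =
    (if x \<le> 1/2 \<and> y \<le> 1/2 then 1/2 * resolvent_term (lam / 4) (2 * x) (2 * y) m else 0)
    + (if 1/2 \<le> x \<and> 1/2 \<le> y
       then 1/2 * resolvent_term (lam / 4) (2 * x - 1) (2 * y - 1) m else 0)"
proof -
  define P where "P \<longleftrightarrow> x \<le> 1/2 \<and> y \<le> 1/2"
  define Q where "Q \<longleftrightarrow> 1/2 \<le> x \<and> 1/2 \<le> y"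
  have "Psi_cell mu (1 # w) x y = (if P then Psi_cell mu w (2 * x) (2 * y) else 0)"
    "Psi_cell mu (2 # w) x y = (if Q then Psi_cell mu w (2 * x - 1) (2 * y - 1) else 0)" for mu w
    using assms by (auto simp: Psi_cell_Cons F_image_unit_interval inv_F P_def Q_def)
  then show ?thesis unfolding P_def[symmetric] Q_def[symmetric]
    by (cases P; cases Q) (simp_all add: resolvent_term_def sum_words_Suc sum_distrib_left)
qed

section \<open>Convergence of the series\<close>

definition remainder :: "nat \<Rightarrow> complex \<Rightarrow> real \<Rightarrow> real \<Rightarrow> complex" where
  "remainder M lam x y = green (csqrt lam) x y - (\<Sum>m<M. resolvent_term lam x y m)"

lemma remainder_Suc:
  assumes "sinhq (csqrt lam) 1 \<noteq> 0" "x \<in> {0..1}" "y \<in> {0..1}"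
  shows "remainder (Suc M) lam x y =
    (if x \<le> 1/2 \<and> y \<le> 1/2 then 1/2 * remainder M (lam / 4) (2 * x) (2 * y) else 0)
    + (if 1/2 \<le> x \<and> 1/2 \<le> y then 1/2 * remainder M (lam / 4) (2 * x - 1) (2 * y - 1) else 0)"
proof -
  define P where "P \<longleftrightarrow> x \<le> 1/2 \<and> y \<le> 1/2"
  define Q where "Q \<longleftrightarrow> 1/2 \<le> x \<and> 1/2 \<le> y"
  show ?thesis
    unfolding remainder_def sum.lessThan_Suc_shift green_self_similar[OF assms] csqrt_quarter
      resolvent_term_0[OF assms(2,3)] resolvent_term_Suc[OF assms(2,3)] Psi_eq[OF assms(1)]
      P_def[symmetric] Q_def[symmetric]
    by (cases P; cases Q) (simp_all add: sum.distrib right_diff_distrib sum_distrib_left)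
qed

text \<open>The vanishing for \<open>x \<in> {0, 1}\<close> is carried along in the induction to deal with \<open>x = 1/2\<close>: there
  both halves contribute, which would double the bound in each step, but both contributions are
  zero. For every other \<open>x\<close> only one half contributes.\<close>
lemma remainder_bound:
  assumes "sinhq (csqrt lam) 1 \<noteq> 0"
    and "\<And>x y. x \<in> {0..1} \<Longrightarrow> y \<in> {0..1} \<Longrightarrow> norm (green (csqrt lam / 2 ^ M) x y) \<le> C"
    and "x \<in> {0..1}" "y \<in> {0..1}"
  shows "norm (remainder M lam x y) \<le> C / 2 ^ M \<and> (x \<in> {0, 1} \<longrightarrow> remainder M lam x y = 0)"
  using assms
proof (induction M arbitrary: lam x y)
  case 0
  then show ?case using green_boundary[of x y] by (auto simp: remainder_def)
next
  case (Suc M)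
  have IH: "norm (remainder M (lam / 4) x' y') \<le> C / 2 ^ M"
    "x' \<in> {0, 1} \<Longrightarrow> remainder M (lam / 4) x' y' = 0" if "x' \<in> {0..1}" "y' \<in> {0..1}" for x' y'
    using Suc.IH[of "lam / 4" x' y'] Suc.prems(1,2) that
    by (auto simp: csqrt_quarter sinhq_1_half_nonzero)
  note rec = remainder_Suc[OF Suc.prems(1,3,4), of M]
  have "0 \<le> norm (green (csqrt lam / 2 ^ Suc M) 0 0)" by simp
  also have "\<dots> \<le> C" by (rule Suc.prems(2)) auto
  finally have "C \<ge> 0" .
  consider "x < 1/2" | "x = 1/2" | "1/2 < x" by linarith
  then show ?case
  proof cases
    case 1
    then show ?thesis
      using Suc.prems(3,4) IH[of "2 * x" "2 * y"] \<open>C \<ge> 0\<close> unfolding rec by (auto simp: norm_mult)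
  next
    case 2
    then have "2 * x = 1" "2 * x - 1 = 0" by auto
    then show ?thesis
      using 2 Suc.prems(3,4) IH(2)[of 1 "2 * y"] IH(2)[of 0 "2 * y - 1"] \<open>C \<ge> 0\<close>
      unfolding rec by (simp only:) auto
  next
    case 3
    then show ?thesis
      using Suc.prems(3,4) IH[of "2 * x - 1" "2 * y - 1"] \<open>C \<ge> 0\<close> unfolding rec by (auto simp: norm_mult)
  qed
qed

text \<open>Rescaling gives \<open>sinhq (s / 2^m) t = 2^m * sinhq s (t / 2^m)\<close>, so a Lipschitz constant of \<open>sinhq s\<close>
  on \<open>[0,1]\<close> serves for all \<open>m\<close> at once.\<close>
lemma sinhq_bound_scaled:
  obtains K where "\<And>m t. t \<in> {0..1} \<Longrightarrow> norm (sinhq (s / 2 ^ m) t) \<le> K"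
proof -
  have "continuous_on {0..1} (\<lambda>t. cosh (s * of_real t))"
    by (rule continuous_on_vector_derivative[OF cosh_has_vector_derivative])
  then have "compact ((\<lambda>t. cosh (s * of_real t)) ` {0..1::real})"
    by (rule compact_continuous_image) simp
  from compact_imp_bounded[OF this]
  obtain K where K: "\<And>t. t \<in> {0..1} \<Longrightarrow> norm (cosh (s * of_real t)) \<le> K"
    unfolding bounded_iff by blast
  have lip: "norm (sinhq s t) \<le> K * t" if "t \<in> {0..1}" for t
  proof -
    have "norm (sinhq s t - sinhq s 0) \<le> K * norm (t - 0)"
    proof (rule differentiable_bound[where S = "{0..1}"])
      fix x :: real assume "x \<in> {0..1}"
      then show "onorm (\<lambda>h. h *\<^sub>R cosh (s * of_real x)) \<le> K"
        using K by (intro onorm_le) (simp add: mult.commute[of K] mult_left_mono)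
    qed (use that sinhq_has_vector_derivative in \<open>auto simp: has_vector_derivative_def\<close>)
    with that show ?thesis by simp
  qed
  have "sinhq (s / 2 ^ m) t = 2 ^ m * sinhq s (t / 2 ^ m)" for m t
  proof (induction m arbitrary: t)
    case (Suc m)
    show ?case
      using sinhq_half_parameter[of "s / 2 ^ m" "t / 2"] Suc[of "t / 2"] by (simp add: field_simps)
  qed simp
  then have "norm (sinhq (s / 2 ^ m) t) \<le> K" if "t \<in> {0..1}" for m t
  proof -
    have "t / 2 ^ m \<le> 1"
      using that by (simp add: divide_le_eq) (meson one_le_numeral one_le_power order_trans)
    then have "norm (sinhq s (t / 2 ^ m)) \<le> K * (t / 2 ^ m)"
      using that by (intro lip) auto
    then have "norm (sinhq (s / 2 ^ m) t) \<le> K * t"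
      using \<open>sinhq (s / 2 ^ m) t = 2 ^ m * sinhq s (t / 2 ^ m)\<close>
      by (simp add: norm_mult norm_power field_simps)
    also have "\<dots> \<le> K * 1"
    proof (rule mult_left_mono)
      show "0 \<le> K" using K[of 0] order_trans[OF norm_ge_zero] by force
    qed (use that in auto)
    finally show ?thesis by simp
  qed
  then show thesis by (rule that)
qed

text \<open>The denominators \<open>sinhq (s / 2^m) 1\<close> tend to 1, so their inverses form a convergent and hence bounded
  sequence; a denominator that vanishes contributes \<open>inverse 0 = 0\<close>.\<close>
lemma green_bound_scaled:
  obtains C where "\<And>m x y. x \<in> {0..1} \<Longrightarrow> y \<in> {0..1} \<Longrightarrow> norm (green (s / 2 ^ m) x y) \<le> C"
proof -
  obtain K where K: "\<And>m t. t \<in> {0..1} \<Longrightarrow> norm (sinhq (s / 2 ^ m) t) \<le> K"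
    by (rule sinhq_bound_scaled) blast
  have "(\<lambda>m. sinhq (s / 2 ^ m) 1) \<longlonglongrightarrow> 1"
  proof (cases "s = 0")
    case False
    have "(\<lambda>m. s / 2 ^ m) \<longlonglongrightarrow> 0"
      by (rule tendsto_divide_0[OF tendsto_const filterlim_realpow_sequentially_gt1]) simp
    then have "filterlim (\<lambda>m. s / 2 ^ m) (at 0) sequentially"
      using False by (simp add: filterlim_at)
    from filterlim_compose[OF sinhq_tendsto[of 1] this] show ?thesis by simp
  qed (simp add: sinhq_def)
  then have "(\<lambda>m. inverse (sinhq (s / 2 ^ m) 1)) \<longlonglongrightarrow> inverse 1"
    by (intro tendsto_inverse) auto
  then have "Bseq (\<lambda>m. inverse (sinhq (s / 2 ^ m) 1))"
    using convergent_imp_Bseq convergentI by blast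
  then obtain L where L: "\<And>m. norm (inverse (sinhq (s / 2 ^ m) 1)) \<le> L"
    unfolding Bseq_def by auto
  have "norm (green (s / 2 ^ m) x y) \<le> K * K * L" if "x \<in> {0..1}" "y \<in> {0..1}" for m x y
  proof -
    have "norm (green (s / 2 ^ m) x y) = norm (sinhq (s / 2 ^ m) (min x y)) *
        norm (sinhq (s / 2 ^ m) (1 - max x y)) * norm (inverse (sinhq (s / 2 ^ m) 1))"
      by (simp add: green_def norm_mult norm_divide norm_inverse divide_inverse)
    also have "\<dots> \<le> K * K * L"
      using that K[of 0 m] K[of "min x y" m]
      by (intro mult_mono K L) (auto intro: order_trans[OF norm_ge_zero])
    finally show ?thesis .
  qed
  then show thesis by (rule that)
qed

lemma resolvent_term_sums_green:
  assumes "sinhq (csqrt lam) 1 \<noteq> 0" "x \<in> {0..1}" "y \<in> {0..1}"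
  shows "resolvent_term lam x y sums green (csqrt lam) x y"
proof -
  obtain C where C: "\<And>m x y. x \<in> {0..1} \<Longrightarrow> y \<in> {0..1} \<Longrightarrow>
      norm (green (csqrt lam / 2 ^ m) x y) \<le> C"
    using green_bound_scaled by blast
  have "(\<lambda>M. remainder M lam x y) \<longlonglongrightarrow> 0"
  proof (rule Lim_null_comparison)
    show "\<forall>\<^sub>F M in sequentially. norm (remainder M lam x y) \<le> C / 2 ^ M"
      using remainder_bound[OF assms(1) C assms(2,3)] by simp
    show "(\<lambda>M. C / 2 ^ M) \<longlonglongrightarrow> 0"
      by (rule LIMSEQ_divide_realpow_zero) simp
  qed
  from tendsto_diff[OF tendsto_const[of "green (csqrt lam) x y"] this]
  show ?thesis by (simp add: remainder_def sums_def)
qed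

section \<open>The Green function is the resolvent kernel\<close>

text \<open>Splitting the integral at the diagonal separates the variables, so that \<open>x\<close> occurs only in smooth
  factors and in limits of integration. The integral over \<open>{x..1}\<close> is written as a difference since
  differentiation is available in the upper limit.\<close>
lemma green_integral_eq:
  assumes f: "continuous_on {0..1} f" and x: "x \<in> {0..1}"
  shows "(\<integral>y. green s x y * f y \<partial>lebesgue_on {0..1}) =
    (sinhq s (1 - x) * integral {0..x} (\<lambda>y. sinhq s y * f y)
     + sinhq s x * (integral {0..1} (\<lambda>y. sinhq s (1 - y) * f y)
                    - integral {0..x} (\<lambda>y. sinhq s (1 - y) * f y))) / sinhq s 1"
proof -
  let ?a = "\<lambda>y. sinhq s y * f y" and ?b = "\<lambda>y. sinhq s (1 - y) * f y"
  let ?g = "\<lambda>y. green s x y * f y"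
  have cont: "continuous_on {0..1} ?a" "continuous_on {0..1} ?b"
    using f by (intro continuous_intros; assumption)+
  have contg: "continuous_on {0..1} ?g"
    by (rule continuous_on_mult[OF continuous_on_green_row f])
  have "integral\<^sup>L (lebesgue_on {0..1}) ?g = integral {0..1} ?g"
    by (intro lebesgue_integral_eq_integral continuous_imp_integrable_real contg) simp
  also have "\<dots> = integral {0..x} ?g + integral {x..1} ?g"
    using x by (intro Henstock_Kurzweil_Integration.integral_combine[symmetric]
        integrable_continuous_real contg) auto
  also have "integral {0..x} ?g = integral {0..x} (\<lambda>y. (sinhq s (1 - x) / sinhq s 1) * ?a y)"
    by (rule Henstock_Kurzweil_Integration.integral_cong)
       (simp add: green_def min_absorb2 max_absorb1)
  also have "integral {x..1} ?g = integral {x..1} (\<lambda>y. (sinhq s x / sinhq s 1) * ?b y)"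
    by (rule Henstock_Kurzweil_Integration.integral_cong)
       (simp add: green_def min_absorb1 max_absorb2)
  also have "integral {x..1} (\<lambda>y. (sinhq s x / sinhq s 1) * ?b y) =
      (sinhq s x / sinhq s 1) * (integral {0..1} ?b - integral {0..x} ?b)"
  proof -
    have "integral {0..x} ?b + integral {x..1} ?b = integral {0..1} ?b"
      using x by (intro Henstock_Kurzweil_Integration.integral_combine
          integrable_continuous_real cont) auto
    then have "integral {x..1} ?b = integral {0..1} ?b - integral {0..x} ?b"
      by (simp add: eq_diff_eq add.commute)
    then show ?thesis by simp
  qed
  finally show ?thesis by (simp add: add_divide_distrib)
qed

text \<open>Variation of parameters. In the first derivative the terms from the limits of integration cancel;
  in the second they add up to \<open>- f\<close> times the Wronskian of \<open>S x\<close> and \<open>S (1 - x)\<close>, whose constant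
  value \<open>S 1\<close> is the denominator of the Green function.\<close>
lemma green_integral_dirichlet_laplacian:
  assumes nz: "sinhq s 1 \<noteq> 0" and f: "continuous_on {0..1} f"
  defines "u \<equiv> \<lambda>x. \<integral>y. green s x y * f y \<partial>lebesgue_on {0..1}"
  shows "dirichlet_laplacian u (\<lambda>x. s\<^sup>2 * u x - f x)"
proof -
  let ?a = "\<lambda>y. sinhq s y * f y" and ?b = "\<lambda>y. sinhq s (1 - y) * f y"
  let ?c = "\<lambda>x. cosh (s * of_real x)"
  define A where "A x = integral {0..x} ?a" for x
  define B where "B x = integral {0..1} ?b - integral {0..x} ?b" for x
  define v where "v x = (sinhq s (1 - x) * A x + sinhq s x * B x) / sinhq s 1" for x
  define v' where "v' x = (?c x * B x - ?c (1 - x) * A x) / sinhq s 1" for x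
  have uv: "u x = v x" if "x \<in> {0..1}" for x
    using green_integral_eq[OF f that] by (simp add: u_def v_def A_def B_def)
  have cont: "continuous_on {0..1} ?a" "continuous_on {0..1} ?b"
    using f by (intro continuous_intros; assumption)+
  have dA: "(A has_vector_derivative ?a x) (at x within {0..1})"
    and dB: "(B has_vector_derivative - ?b x) (at x within {0..1})" if "x \<in> {0..1}" for x
  proof -
    show "(A has_vector_derivative ?a x) (at x within {0..1})"
      using integral_has_vector_derivative[OF cont(1) that] by (simp add: A_def[abs_def])
    have "((\<lambda>x. integral {0..1} ?b - integral {0..x} ?b) has_vector_derivative 0 - ?b x)
        (at x within {0..1})"
      by (intro has_vector_derivative_diff has_vector_derivative_const
          integral_has_vector_derivative[OF cont(2) that])
    then show "(B has_vector_derivative - ?b x) (at x within {0..1})"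
      by (simp add: B_def[abs_def])
  qed
  have refl: "((\<lambda>x. h (1 - x)) has_vector_derivative - h') (at x within {0..1})"
    if "(h has_vector_derivative h') (at (1 - x))" for h :: "real \<Rightarrow> complex" and h' x
  proof -
    have "((\<lambda>x. 1 - x) has_real_derivative -1) (at x within {0..1})"
      by (auto intro!: derivative_eq_intros)
    from vector_diff_chain_within[OF this[unfolded has_real_derivative_iff_has_vector_derivative]
        has_vector_derivative_at_within[OF that]]
    show ?thesis by (simp add: o_def)
  qed
  have dS: "((\<lambda>x. sinhq s (1 - x)) has_vector_derivative - ?c (1 - x)) (at x within {0..1})"
    and dC: "((\<lambda>x. ?c (1 - x)) has_vector_derivative - (s\<^sup>2 * sinhq s (1 - x))) (at x within {0..1})"
    for x
    by (rule refl, rule sinhq_has_vector_derivative, rule refl, rule cosh_has_vector_derivative)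
  have wronskian: "sinhq s x * ?c (1 - x) + ?c x * sinhq s (1 - x) = sinhq s 1" for x
    using sinhq_add[of s x "1 - x"] by simp
  have dv: "(v has_vector_derivative v' x) (at x within {0..1})" if "x \<in> {0..1}" for x
  proof -
    have "((\<lambda>x. (sinhq s (1 - x) * A x + sinhq s x * B x) / sinhq s 1) has_vector_derivative
        ((sinhq s (1 - x) * ?a x + - ?c (1 - x) * A x) + (sinhq s x * - ?b x + ?c x * B x)) / sinhq s 1)
        (at x within {0..1})"
      by (intro has_vector_derivative_divide has_vector_derivative_add has_vector_derivative_mult
          dS dA dB sinhq_has_vector_derivative that)
    then show ?thesis by (simp add: v_def[abs_def] v'_def algebra_simps)
  qed
  have dv': "(v' has_vector_derivative s\<^sup>2 * v x - f x) (at x within {0..1})" if "x \<in> {0..1}" for x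
  proof -
    have "((\<lambda>x. (?c x * B x - ?c (1 - x) * A x) / sinhq s 1) has_vector_derivative
        ((?c x * - ?b x + (s\<^sup>2 * sinhq s x) * B x)
         - (?c (1 - x) * ?a x + - (s\<^sup>2 * sinhq s (1 - x)) * A x)) / sinhq s 1)
        (at x within {0..1})"
      by (intro has_vector_derivative_divide has_vector_derivative_diff has_vector_derivative_mult
          dC dA dB cosh_has_vector_derivative that)
    also have "(?c x * - ?b x + (s\<^sup>2 * sinhq s x) * B x)
         - (?c (1 - x) * ?a x + - (s\<^sup>2 * sinhq s (1 - x)) * A x)
       = s\<^sup>2 * (sinhq s (1 - x) * A x + sinhq s x * B x)
         - (sinhq s x * ?c (1 - x) + ?c x * sinhq s (1 - x)) * f x"
      by (simp add: algebra_simps)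
    also have "\<dots> / sinhq s 1 = s\<^sup>2 * v x - f x"
      using nz unfolding wronskian by (simp add: v_def diff_divide_distrib)
    finally show ?thesis by (simp add: v'_def[abs_def])
  qed
  show ?thesis
    unfolding dirichlet_laplacian_def
  proof (intro conjI exI[of _ v'] ballI)
    show "u 0 = 0" "u 1 = 0" by (simp_all add: uv v_def A_def B_def)
    fix x :: real assume x: "x \<in> {0..1}"
    show "(u has_vector_derivative v' x) (at x within {0..1})"
      by (rule has_vector_derivative_transform[OF x _ dv[OF x]]) (simp add: uv)
    show "(v' has_vector_derivative s\<^sup>2 * u x - f x) (at x within {0..1})"
      using dv'[OF x] x by (simp add: uv)
  qed
qed

text \<open>The difference of two solutions would be an eigenfunction.\<close>
lemma solves_resolvent_eq_unique:
  assumes "\<not> dirichlet_eigenvalue lam" "solves_resolvent_eq lam f u" "solves_resolvent_eq lam f v"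
    and "x \<in> {0..1}"
  shows "v x = u x"
proof -
  obtain g where g: "dirichlet_laplacian u g" "\<And>x. x \<in> {0..1} \<Longrightarrow> lam * u x - g x = f x"
    using assms(2) unfolding solves_resolvent_eq_def by blast
  obtain h where h: "dirichlet_laplacian v h" "\<And>x. x \<in> {0..1} \<Longrightarrow> lam * v x - h x = f x"
    using assms(3) unfolding solves_resolvent_eq_def by blast
  obtain u' where u': "\<And>x. x \<in> {0..1} \<Longrightarrow> (u has_vector_derivative u' x) (at x within {0..1})"
    "\<And>x. x \<in> {0..1} \<Longrightarrow> (u' has_vector_derivative g x) (at x within {0..1})"
    and u0: "u 0 = 0" "u 1 = 0"
    using g(1) unfolding dirichlet_laplacian_def by blast
  obtain v' where v': "\<And>x. x \<in> {0..1} \<Longrightarrow> (v has_vector_derivative v' x) (at x within {0..1})"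
    "\<And>x. x \<in> {0..1} \<Longrightarrow> (v' has_vector_derivative h x) (at x within {0..1})"
    and v0: "v 0 = 0" "v 1 = 0"
    using h(1) unfolding dirichlet_laplacian_def by blast
  have "dirichlet_laplacian (\<lambda>x. v x - u x) (\<lambda>x. lam * (v x - u x))"
    unfolding dirichlet_laplacian_def
  proof (intro conjI exI[of _ "\<lambda>x. v' x - u' x"] ballI)
    fix x :: real assume x: "x \<in> {0..1}"
    show "((\<lambda>x. v x - u x) has_vector_derivative v' x - u' x) (at x within {0..1})"
      by (intro has_vector_derivative_diff u' v' x)
    have "lam * (v x - u x) = h x - g x"
      using g(2)[OF x] h(2)[OF x] by (simp add: algebra_simps)
    then show "((\<lambda>x. v' x - u' x) has_vector_derivative lam * (v x - u x)) (at x within {0..1})"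
      using has_vector_derivative_diff[OF v'(2) u'(2)] x by simp
  qed (simp_all add: u0 v0)
  then have "v x - u x \<noteq> 0 \<Longrightarrow> dirichlet_eigenvalue lam"
    unfolding dirichlet_eigenvalue_def using assms(4)
    by (intro exI[of _ "\<lambda>x. v x - u x"] conjI bexI[of _ x])
  with assms(1) show ?thesis by auto
qed

lemma green_resolvent_kernel:
  assumes "\<not> dirichlet_eigenvalue lam"
  shows "resolvent_kernel lam (green (csqrt lam))"
  unfolding resolvent_kernel_def
proof (intro allI impI conjI ballI)
  fix f :: "real \<Rightarrow> complex" assume f: "continuous_on {0..1} f"
  let ?s = "csqrt lam"
  let ?u = "\<lambda>x. \<integral>y. green ?s x y * f y \<partial>lebesgue_on {0..1}"
  have nz: "sinhq ?s 1 \<noteq> 0"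
    using sinhq_zero_imp_dirichlet_eigenvalue assms by blast
  show "integrable (lebesgue_on {0..1}) (\<lambda>y. green ?s x y * f y)" for x
  proof (rule continuous_imp_integrable_real)
    show "continuous_on {0..1} (\<lambda>y. green ?s x y * f y)"
      by (rule continuous_on_mult[OF continuous_on_green_row f])
  qed
  have "solves_resolvent_eq lam f ?u"
    using green_integral_dirichlet_laplacian[OF nz f]
    unfolding solves_resolvent_eq_def by (intro exI[of _ "\<lambda>x. ?s\<^sup>2 * ?u x - f x"]) simp
  then show "is_resolvent lam f ?u"
    unfolding is_resolvent_def using solves_resolvent_eq_unique[OF assms] by blast
qed

section \<open>Uniqueness of the kernel almost everywhere\<close>

text \<open>A function whose integral over every measurable set vanishes is zero almost everywhere, and the
  indicator function of a measurable set is an almost everywhere limit of continuous functions.\<close>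
lemma AE_zero_if_orthogonal_to_continuous:
  fixes h :: "real \<Rightarrow> complex"
  assumes h: "integrable (lebesgue_on {a..b}) h"
    and orth: "\<And>f. continuous_on {a..b} f \<Longrightarrow> (\<integral>y. h y * f y \<partial>lebesgue_on {a..b}) = 0"
  shows "AE y in lebesgue_on {a..b}. h y = 0"
proof -
  let ?M = "lebesgue_on {a..b}"
  interpret sigma_finite_measure ?M
    by (intro finite_measure.axioms finite_measure_lebesgue_on) simp
  have [measurable]: "h \<in> borel_measurable ?M" using h by auto
  show ?thesis
  proof (rule density_zero[OF h])
    fix A assume A: "A \<in> sets ?M"
    then have "A \<in> sets lebesgue" by (auto simp: sets_restrict_space)
    from indicator_measurable_on[OF this] obtain N g where
      N: "negligible N" and g: "\<And>n. continuous_on UNIV (g n)"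
      and lim: "\<And>x. x \<notin> N \<Longrightarrow> (\<lambda>n. g n x) \<longlonglongrightarrow> indicat_real A x"
      unfolding measurable_on_def by auto
    \<comment> \<open>truncation to \<open>[0,1]\<close> makes the norm of \<open>h\<close> a dominating function\<close>
    define p where "p n x = max 0 (min 1 (g n x))" for n x
    have p: "continuous_on {a..b} (p n)" for n
      unfolding p_def using continuous_on_subset[OF g, of "{a..b}"] by (intro continuous_intros) auto
    have p_lim: "(\<lambda>n. p n x) \<longlonglongrightarrow> indicat_real A x" if "x \<notin> N" for x
    proof -
      have "(\<lambda>n. max 0 (min 1 (g n x))) \<longlonglongrightarrow> max 0 (min 1 (indicat_real A x))"
        by (intro tendsto_intros lim that)
      then show ?thesis by (simp add: p_def indicator_def split: if_splits)
    qed
    have [measurable]: "p n \<in> borel_measurable ?M" for n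
      by (rule continuous_imp_measurable_on_sets_lebesgue[OF p]) simp
    have AE_N: "AE x in ?M. x \<notin> N"
      using N by (auto simp: AE_restrict_space_iff negligible_iff_null_sets intro: AE_not_in[THEN eventually_mono])
    have "(\<lambda>n. \<integral>y. h y * of_real (p n y) \<partial>?M) \<longlonglongrightarrow> (\<integral>y. indicat_real A y *\<^sub>R h y \<partial>?M)"
    proof (rule integral_dominated_convergence[where w = "\<lambda>y. norm (h y)"])
      show "AE y in ?M. (\<lambda>n. h y * of_real (p n y)) \<longlonglongrightarrow> indicat_real A y *\<^sub>R h y"
        using AE_N
      proof eventually_elim
        case (elim y)
        have "(\<lambda>n. p n y *\<^sub>R h y) \<longlonglongrightarrow> indicat_real A y *\<^sub>R h y"
          by (intro tendsto_intros p_lim elim)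
        then show ?case by (simp add: scaleR_conv_of_real mult.commute)
      qed
      show "AE y in ?M. norm (h y * of_real (p n y)) \<le> norm (h y)" for n
        by (auto simp: norm_mult p_def intro!: mult_left_le)
    qed (use A h in auto)
    moreover have "(\<integral>y. h y * of_real (p n y) \<partial>?M) = 0" for n
      by (intro orth continuous_intros p)
    ultimately show "set_lebesgue_integral ?M A h = 0"
      unfolding set_lebesgue_integral_def by (simp add: LIMSEQ_const_iff)
  qed
qed

lemma resolvent_kernel_unique_AE:
  assumes K: "resolvent_kernel lam K" and G: "resolvent_kernel lam G" and x: "x \<in> {0..1}"
  shows "AE y in lebesgue_on {0..1}. K x y = G x y"
proof -
  let ?M = "lebesgue_on {0..1::real}"
  have int: "integrable ?M (\<lambda>y. K x y * f y)" "integrable ?M (\<lambda>y. G x y * f y)"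
    if "continuous_on {0..1} f" for f
    using K G x that unfolding resolvent_kernel_def by blast+
  have eq: "(\<integral>y. K x y * f y \<partial>?M) = (\<integral>y. G x y * f y \<partial>?M)" if "continuous_on {0..1} f" for f
    using K G x that unfolding resolvent_kernel_def is_resolvent_def by blast
  have "AE y in ?M. K x y - G x y = 0"
  proof (rule AE_zero_if_orthogonal_to_continuous)
    show "integrable ?M (\<lambda>y. K x y - G x y)"
      using int[of "\<lambda>_. 1"] by auto
    show "(\<integral>y. (K x y - G x y) * f y \<partial>?M) = 0" if "continuous_on {0..1} f" for f
      using int[OF that] eq[OF that] by (simp add: left_diff_distrib)
  qed
  then show ?thesis by simp
qed

theorem proposition2p1:
  fixes lam :: complex
  assumes "\<not> dirichlet_eigenvalue lam"
  shows "(\<exists>G. resolvent_kernel lam G \<and>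
              continuous_on ({0..1} \<times> {0..1}) (\<lambda>(x, y). G x y) \<and>
              (\<forall>x\<in>{0..1}. \<forall>y\<in>{0..1}. resolvent_term lam x y sums G x y)) \<and>
         (\<forall>K. resolvent_kernel lam K \<longrightarrow>
              (\<forall>x\<in>{0..1}. AE y in lebesgue_on {0..1}. resolvent_term lam x y sums K x y))"
proof -
  let ?G = "green (csqrt lam)"
  have nz: "sinhq (csqrt lam) 1 \<noteq> 0"
    using sinhq_zero_imp_dirichlet_eigenvalue assms by blast
  have G: "resolvent_kernel lam ?G"
    by (rule green_resolvent_kernel[OF assms])
  have sums: "resolvent_term lam x y sums ?G x y" if "x \<in> {0..1}" "y \<in> {0..1}" for x y
    by (rule resolvent_term_sums_green[OF nz that])
  have "AE y in lebesgue_on {0..1}. resolvent_term lam x y sums K x y"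
    if "resolvent_kernel lam K" "x \<in> {0..1}" for K x
    using resolvent_kernel_unique_AE[OF that(1) G that(2)] AE_space
  proof eventually_elim
    case (elim y)
    then show ?case using sums[OF that(2), of y] by simp
  qed
  then show ?thesis using G continuous_on_green sums by blast
qed

end
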